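(* Let $(\alpha_1,\alpha_2)\in\mathbb{R}^2$ and let $f\in D_{(\alpha_1,\alpha_2)}$. Then $f_{w_0}\in D_{\alpha_1}$ for each $w_0\in\mathbb{U}$, and $f_{z_0}\in D_{\alpha_2}$ for each $z_0\in\mathbb{U}$.
   Context: $\mathbb{U}$ is the open unit disc in $\mathbb{C}$, $\mathbb{U}^2=\mathbb{U}\times\mathbb{U}$, and $\mathbb{Z}_+$ is the set of nonnegative integers. For $(\alpha_1,\alpha_2)\in\mathbb{R}^2$, $D_{(\alpha_1,\alpha_2)}$ is the space of functions $f(z,w)=\sum_{(k,l)\in\mathbb{Z}_+^2}a_{k,l}z^kw^l$ on $\mathbb{U}^2$ with $\sum_{(k,l)}|a_{k,l}|^2(k+1)^{\alpha_1}(l+1)^{\alpha_2}<\infty$. For $a\in\mathbb{R}$, $D_a$ is the one-variable space of functions $g(z)=\sum_{k\in\mathbb{Z}_+}b_kz^k$ on $\mathbb{U}$ with $\sum_k|b_k|^2(k+1)^a<\infty$. For $f:\mathbb{U}^2\to\mathbb{C}$ and fixed $w_0\in\mathbb{U}$, $f_{w_0}:\mathbb{U}\to\mathbb{C}$ is the slice in the first variable, $f_{w_0}(z)=f(z,w_0)$; for fixed $z_0\in\mathbb{U}$, $f_{z_0}:\mathbb{U}\to\mathbb{C}$ is the slice in the second variable, $f_{z_0}(w)=f(z_0,w)$. *)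

theory Defs
  imports "HOL-Analysis.Analysis"
begin

abbreviation unit_disc :: "complex set" where
  "unit_disc \<equiv> ball 0 1"

(* Functions on the disc (bidisc) are total functions of which only the values on the
   disc (bidisc) matter: nothing is required of them elsewhere. *)

definition D1_space :: "real \<Rightarrow> (complex \<Rightarrow> complex) set" where
  "D1_space \<alpha> = {g. \<exists>b :: nat \<Rightarrow> complex.
     (\<forall>z \<in> unit_disc. (\<lambda>k. b k * z ^ k) sums g z) \<and>
     summable (\<lambda>k. (cmod (b k))\<^sup>2 * (real k + 1) powr \<alpha>)}"

(* Double series are unordered sums over pairs of naturals. The weighted square-summability
   of the coefficients makes the power series absolutely convergent on the bidisc, so the
   order of summation is immaterial. *)

definition D2_space :: "real \<Rightarrow> real \<Rightarrow> (complex \<times> complex \<Rightarrow> complex) set" where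
  "D2_space \<alpha>\<^sub>1 \<alpha>\<^sub>2 = {f. \<exists>a :: nat \<Rightarrow> nat \<Rightarrow> complex.
     (\<forall>z \<in> unit_disc. \<forall>w \<in> unit_disc.
        ((\<lambda>(k, l). a k l * z ^ k * w ^ l) has_sum f (z, w)) UNIV) \<and>
     (\<lambda>(k, l). (cmod (a k l))\<^sup>2 * (real k + 1) powr \<alpha>\<^sub>1 * (real l + 1) powr \<alpha>\<^sub>2)
        summable_on UNIV}"

definition slice_fst :: "(complex \<times> complex \<Rightarrow> complex) \<Rightarrow> complex \<Rightarrow> complex \<Rightarrow> complex" where
  "slice_fst f w\<^sub>0 = (\<lambda>z. f (z, w\<^sub>0))"

definition slice_snd :: "(complex \<times> complex \<Rightarrow> complex) \<Rightarrow> complex \<Rightarrow> complex \<Rightarrow> complex" where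
  "slice_snd f z\<^sub>0 = (\<lambda>w. f (z\<^sub>0, w))"

end

theory Submission
  imports Defs
begin

text \<open>
  Fixing \<open>w\<close> turns the double series of \<open>f\<close> into a power series in \<open>z\<close> with coefficients
  \<open>b\<^sub>k = \<Sum>\<^sub>l a\<^sub>k\<^sub>l w\<^sup>l\<close>. Cauchy--Schwarz in the variable \<open>l\<close>, with the weight of the space put on
  \<open>a\<close> and its reciprocal put on the powers of \<open>w\<close>, gives
  \<open>\<bar>b\<^sub>k\<bar>\<^sup>2 \<le> (\<Sum>\<^sub>l \<bar>a\<^sub>k\<^sub>l\<bar>\<^sup>2 (l + 1)\<^sup>\<beta>) (\<Sum>\<^sub>l \<bar>w\<bar>\<^sup>2\<^sup>l (l + 1)\<^sup>-\<^sup>\<beta>)\<close> with \<open>\<beta> = \<alpha>\<^sub>2\<close>.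
  The last factor is finite for every real \<open>\<beta>\<close> because geometric decay beats every power
  (\<open>summable_power_times_powr\<close>), and it does not depend on \<open>k\<close>. Multiplying by
  \<open>(k + 1)\<^sup>\<alpha>\<close> with \<open>\<alpha> = \<alpha>\<^sub>1\<close> and summing over \<open>k\<close> bounds the norm of the slice by
  a multiple of the norm of \<open>f\<close>. The other slice follows by exchanging the two variables.
\<close>

text \<open>By the ratio test: consecutive terms have a ratio tending to \<open>r\<close>, whatever the exponent.\<close>

lemma summable_power_times_powr:
  fixes r \<beta> :: real
  assumes "0 \<le> r" "r < 1"
  shows "summable (\<lambda>n. r ^ n * (real n + 1) powr \<beta>)"
proof -
  define q where "q n = (real (Suc n) + 1) / (real n + 1)" for n
  have "(\<lambda>n. 1 + inverse (real (Suc n))) \<longlonglongrightarrow> 1 + 0"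
    by (intro tendsto_intros LIMSEQ_inverse_real_of_nat)
  moreover have "q = (\<lambda>n. 1 + inverse (real (Suc n)))"
    by (auto simp: q_def field_simps)
  ultimately have "q \<longlonglongrightarrow> 1"
    by simp
  then have "(\<lambda>n. r * q n powr \<beta>) \<longlonglongrightarrow> r * 1 powr \<beta>"
    by (intro tendsto_intros) auto
  moreover have "r * 1 powr \<beta> < (1 + r) / 2"
    using assms by simp
  ultimately have "eventually (\<lambda>n. r * q n powr \<beta> < (1 + r) / 2) sequentially"
    by (rule order_tendstoD)
  then obtain N where N: "\<And>n. n \<ge> N \<Longrightarrow> r * q n powr \<beta> < (1 + r) / 2"
    unfolding eventually_sequentially by blast
  show ?thesis
  proof (rule summable_ratio_test)
    show "(1 + r) / 2 < 1"
      using assms by simp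
    fix n assume "n \<ge> N"
    have "(real (Suc n) + 1) powr \<beta> = q n powr \<beta> * (real n + 1) powr \<beta>"
      unfolding q_def by (subst powr_mult [symmetric]) auto
    then have "norm (r ^ Suc n * (real (Suc n) + 1) powr \<beta>)
        = (r * q n powr \<beta>) * norm (r ^ n * (real n + 1) powr \<beta>)"
      using assms by (simp add: abs_mult)
    also have "\<dots> \<le> (1 + r) / 2 * norm (r ^ n * (real n + 1) powr \<beta>)"
      using N[OF \<open>n \<ge> N\<close>] by (intro mult_right_mono) auto
    finally show "norm (r ^ Suc n * (real (Suc n) + 1) powr \<beta>)
        \<le> (1 + r) / 2 * norm (r ^ n * (real n + 1) powr \<beta>)" .
  qed
qed

text \<open>The bound for finite partial sums is uniform, so it gives both absolute convergence of the
  product series and, in the limit, the bound for its sum.\<close>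

lemma weighted_Cauchy_Schwarz_infsum:
  fixes u v :: "'a \<Rightarrow> 'b :: {real_normed_field, banach}" and p :: "'a \<Rightarrow> real"
  assumes p: "\<And>x. x \<in> X \<Longrightarrow> p x > 0"
    and u: "(\<lambda>x. (norm (u x))\<^sup>2 * p x) summable_on X"
    and v: "(\<lambda>x. (norm (v x))\<^sup>2 / p x) summable_on X"
  shows "(\<lambda>x. norm (u x * v x)) summable_on X"
    and "(norm (\<Sum>\<^sub>\<infinity>x\<in>X. u x * v x))\<^sup>2
      \<le> (\<Sum>\<^sub>\<infinity>x\<in>X. (norm (u x))\<^sup>2 * p x) * (\<Sum>\<^sub>\<infinity>x\<in>X. (norm (v x))\<^sup>2 / p x)"
proof -
  define A where "A = (\<Sum>\<^sub>\<infinity>x\<in>X. (norm (u x))\<^sup>2 * p x)"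
  define B where "B = (\<Sum>\<^sub>\<infinity>x\<in>X. (norm (v x))\<^sup>2 / p x)"
  have AB: "A \<ge> 0" "B \<ge> 0"
    unfolding A_def B_def using p by (auto intro!: infsum_nonneg simp: less_imp_le)
  have fin: "(\<Sum>x\<in>F. norm (u x * v x)) \<le> sqrt (A * B)" if F: "finite F" "F \<subseteq> X" for F
  proof (rule real_le_rsqrt)
    have "(\<Sum>x\<in>F. norm (u x * v x))
        = (\<Sum>x\<in>F. (norm (u x) * sqrt (p x)) * (norm (v x) / sqrt (p x)))"
      using F p by (intro sum.cong refl) (force simp: norm_mult)
    then have "(\<Sum>x\<in>F. norm (u x * v x))\<^sup>2
        \<le> (\<Sum>x\<in>F. (norm (u x) * sqrt (p x))\<^sup>2) * (\<Sum>x\<in>F. (norm (v x) / sqrt (p x))\<^sup>2)"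
      by (simp only: Cauchy_Schwarz_ineq_sum)
    also have "(\<Sum>x\<in>F. (norm (u x) * sqrt (p x))\<^sup>2) = (\<Sum>x\<in>F. (norm (u x))\<^sup>2 * p x)"
      using F p by (intro sum.cong refl) (auto simp: power_mult_distrib less_imp_le subset_iff)
    also have "(\<Sum>x\<in>F. (norm (v x) / sqrt (p x))\<^sup>2) = (\<Sum>x\<in>F. (norm (v x))\<^sup>2 / p x)"
      using F p by (intro sum.cong refl) (auto simp: power_divide less_imp_le subset_iff)
    also have "(\<Sum>x\<in>F. (norm (u x))\<^sup>2 * p x) * (\<Sum>x\<in>F. (norm (v x))\<^sup>2 / p x) \<le> A * B"
      unfolding A_def B_def using F p u v
      by (intro mult_mono finite_sum_le_infsum sum_nonneg infsum_nonneg)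
        (auto simp: less_imp_le subset_iff)
    finally show "(\<Sum>x\<in>F. norm (u x * v x))\<^sup>2 \<le> A * B" .
  qed
  show abs: "(\<lambda>x. norm (u x * v x)) summable_on X"
    by (rule nonneg_bdd_above_summable_on) (auto intro!: bdd_aboveI2[where M = "sqrt (A * B)"] fin)
  have "norm (\<Sum>\<^sub>\<infinity>x\<in>X. u x * v x) \<le> (\<Sum>\<^sub>\<infinity>x\<in>X. norm (u x * v x))"
    using abs by (rule norm_infsum_bound)
  also have "\<dots> \<le> sqrt (A * B)"
    using abs fin by (rule infsum_le_finite_sums)
  finally have "(norm (\<Sum>\<^sub>\<infinity>x\<in>X. u x * v x))\<^sup>2 \<le> (sqrt (A * B))\<^sup>2"
    by (intro power_mono) auto
  then show "(norm (\<Sum>\<^sub>\<infinity>x\<in>X. u x * v x))\<^sup>2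
      \<le> (\<Sum>\<^sub>\<infinity>x\<in>X. (norm (u x))\<^sup>2 * p x) * (\<Sum>\<^sub>\<infinity>x\<in>X. (norm (v x))\<^sup>2 / p x)"
    using AB by (simp add: A_def B_def)
qed

text \<open>The coefficients \<open>b\<close> of the slice are the row sums of \<open>a k l * w ^ l\<close>; the Cauchy--Schwarz
  constant \<open>C\<close> is the same for all rows, so Fubini for the weighted double series of \<open>a\<close>
  yields the square-summability of \<open>b\<close>.\<close>

lemma slice_fst_in_D1_space:
  assumes f: "f \<in> D2_space \<alpha> \<beta>" and w: "w \<in> unit_disc"
  shows "slice_fst f w \<in> D1_space \<alpha>"
proof -
  from f obtain a :: "nat \<Rightarrow> nat \<Rightarrow> complex" where
    sum: "\<And>z. z \<in> unit_disc \<Longrightarrow> ((\<lambda>(k, l). a k l * z ^ k * w ^ l) has_sum f (z, w)) UNIV"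
    and norm: "(\<lambda>(k, l). (cmod (a k l))\<^sup>2 * (real k + 1) powr \<alpha> * (real l + 1) powr \<beta>)
      summable_on UNIV"
    unfolding D2_space_def using w by blast
  define b where "b k = (\<Sum>\<^sub>\<infinity>l. a k l * w ^ l)" for k
  define A where "A k = (\<Sum>\<^sub>\<infinity>l. (cmod (a k l))\<^sup>2 * (real l + 1) powr \<beta>)" for k
  define C where "C = (\<Sum>\<^sub>\<infinity>l. (cmod (w ^ l))\<^sup>2 / (real l + 1) powr \<beta>)"

  have norm': "(\<lambda>(k, l). (real k + 1) powr \<alpha> * ((cmod (a k l))\<^sup>2 * (real l + 1) powr \<beta>))
      summable_on UNIV \<times> UNIV"
    using norm by (simp add: mult_ac)
  have row: "(\<lambda>l. (cmod (a k l))\<^sup>2 * (real l + 1) powr \<beta>) summable_on UNIV" for k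
  proof -
    have "(\<lambda>l. (real k + 1) powr \<alpha> * ((cmod (a k l))\<^sup>2 * (real l + 1) powr \<beta>)) summable_on UNIV"
      using summable_on_SigmaD1[OF norm'] by simp
    then show ?thesis
      by (subst (asm) summable_on_cmult_right') auto
  qed
  have "(\<lambda>k. (\<Sum>\<^sub>\<infinity>l. (real k + 1) powr \<alpha> * ((cmod (a k l))\<^sup>2 * (real l + 1) powr \<beta>)))
      summable_on UNIV"
    using summable_on_Sigma_banach[OF norm'] .
  then have weighted_A: "summable (\<lambda>k. (real k + 1) powr \<alpha> * A k)"
    unfolding A_def by (intro summable_on_imp_summable) (simp add: infsum_cmult_right')

  have "(cmod (w ^ l))\<^sup>2 / (real l + 1) powr \<beta> = ((cmod w)\<^sup>2) ^ l * (real l + 1) powr (- \<beta>)" for l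
    by (simp add: norm_power powr_minus divide_inverse mult.commute flip: power_mult)
  moreover have "summable (\<lambda>l. ((cmod w)\<^sup>2) ^ l * (real l + 1) powr (- \<beta>))"
    using w by (intro summable_power_times_powr) (auto simp: power_less_one_iff)
  ultimately have geom: "(\<lambda>l. (cmod (w ^ l))\<^sup>2 / (real l + 1) powr \<beta>) summable_on UNIV"
    by (intro summable_nonneg_imp_summable_on) auto

  have inner: "(\<lambda>l. norm (a k l * w ^ l)) summable_on UNIV"
    and bound: "(cmod (b k))\<^sup>2 \<le> A k * C" for k
    unfolding b_def A_def C_def
    using weighted_Cauchy_Schwarz_infsum[of UNIV "\<lambda>l. (real l + 1) powr \<beta>" "a k" "\<lambda>l. w ^ l"]
      row[of k] geom by auto
  have "(\<lambda>k. b k * z ^ k) sums slice_fst f w z" if z: "z \<in> unit_disc" for z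
    unfolding slice_fst_def
  proof (rule has_sum_imp_sums, rule has_sum_SigmaD)
    show "((\<lambda>(k, l). a k l * z ^ k * w ^ l) has_sum f (z, w)) (UNIV \<times> UNIV)"
      using sum[OF z] by simp
    fix k
    have "((\<lambda>l. a k l * w ^ l * z ^ k) has_sum b k * z ^ k) UNIV"
      unfolding b_def
      by (rule has_sum_cmult_left, rule has_sum_infsum, rule abs_summable_summable, rule inner)
    then show "((\<lambda>l. case (k, l) of (k, l) \<Rightarrow> a k l * z ^ k * w ^ l) has_sum b k * z ^ k) UNIV"
      by (simp add: mult_ac)
  qed
  moreover have "summable (\<lambda>k. (cmod (b k))\<^sup>2 * (real k + 1) powr \<alpha>)"
  proof (rule summable_comparison_test')
    show "summable (\<lambda>k. C * ((real k + 1) powr \<alpha> * A k))"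
      using weighted_A by (rule summable_mult)
    show "norm ((cmod (b k))\<^sup>2 * (real k + 1) powr \<alpha>) \<le> C * ((real k + 1) powr \<alpha> * A k)" for k
      using mult_right_mono[OF bound[of k], of "(real k + 1) powr \<alpha>"] by (simp add: mult_ac)
  qed
  ultimately show ?thesis
    unfolding D1_space_def by blast
qed

lemma D2_space_swap:
  assumes "f \<in> D2_space \<alpha> \<beta>"
  shows "f \<circ> prod.swap \<in> D2_space \<beta> \<alpha>"
proof -
  from assms obtain a :: "nat \<Rightarrow> nat \<Rightarrow> complex" where
    sum: "\<And>z w. z \<in> unit_disc \<Longrightarrow> w \<in> unit_disc \<Longrightarrow>
      ((\<lambda>(k, l). a k l * z ^ k * w ^ l) has_sum f (z, w)) (UNIV \<times> UNIV)"
    and norm: "(\<lambda>(k, l). (cmod (a k l))\<^sup>2 * (real k + 1) powr \<alpha> * (real l + 1) powr \<beta>)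
      summable_on UNIV \<times> UNIV"
    unfolding D2_space_def UNIV_Times_UNIV by blast
  have "((\<lambda>(l, k). a k l * w ^ l * z ^ k) has_sum f (z, w)) UNIV"
    if "z \<in> unit_disc" "w \<in> unit_disc" for z w
    using sum[OF that] by (subst (asm) has_sum_swap) (simp add: mult_ac)
  moreover have "(\<lambda>(l, k). (cmod (a k l))\<^sup>2 * (real l + 1) powr \<beta> * (real k + 1) powr \<alpha>)
      summable_on UNIV"
    using norm by (subst (asm) summable_on_swap) (simp add: mult_ac)
  ultimately show ?thesis
    unfolding D2_space_def by (intro CollectI exI[of _ "\<lambda>l k. a k l"]) auto
qed

theorem theorem4p2:
  fixes \<alpha>\<^sub>1 \<alpha>\<^sub>2 :: real and f :: "complex \<times> complex \<Rightarrow> complex"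
  assumes "f \<in> D2_space \<alpha>\<^sub>1 \<alpha>\<^sub>2"
  shows "(\<forall>w\<^sub>0 \<in> unit_disc. slice_fst f w\<^sub>0 \<in> D1_space \<alpha>\<^sub>1) \<and>
         (\<forall>z\<^sub>0 \<in> unit_disc. slice_snd f z\<^sub>0 \<in> D1_space \<alpha>\<^sub>2)"
proof -
  have "slice_snd f z = slice_fst (f \<circ> prod.swap) z" for z
    by (simp add: slice_fst_def slice_snd_def fun_eq_iff)
  then show ?thesis
    using slice_fst_in_D1_space[OF assms] slice_fst_in_D1_space[OF D2_space_swap[OF assms]]
    by simp
qed

end
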